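(* Let $q$ be a prime power, $n\ge1$ an integer, and let $f(x),g(x),h(x)\in\mathbf{F}_{q^2}[x]$ be monic polynomials of degree less than $n$ such that $f(x)$ and $g(x)$ divide $x^n-1$. If $f(x)\mid g(x)\mid {g^{[q]}}^\perp(x)\mid {f^{[q]}}^\perp(x)$, then the quasi-cyclic code $Q_{q^2}(f,g,h)\subset\mathbf{F}_{q^2}^{2n}$ contains its Hermitian dual.
   Context: $R=\mathbf{F}_{q^2}[x]/(x^n-1)$ and $[a(x)]$ is the class of $a(x)$ in $R$. A vector $(a_0,\ldots,a_{n-1})\in\mathbf{F}_{q^2}^n$ is identified with $[a_0+a_1x+\cdots+a_{n-1}x^{n-1}]\in R$, and $\mathbf{F}_{q^2}^{2n}$ is identified with $R^2$ accordingly (first $n$ coordinates, last $n$ coordinates). $Q_{q^2}(f,g,h)$ is the $R$-submodule of $R^2$ generated by $([f(x)],[h(x)f(x)])$ and $(0,[g(x)])$. For $u(x)=\sum_i a_ix^i$ put $u^{[q]}(x)=\sum_i a_i^qx^i$. For a divisor $u(x)$ of $x^n-1$, let $u'(x)$ be defined by $u(x)u'(x)=x^n-1$ and put $u^\perp(x)=x^{\deg u'}u'(1/x)$; ${f^{[q]}}^\perp$ and ${g^{[q]}}^\perp$ mean $(f^{[q]})^\perp$ and $(g^{[q]})^\perp$. Hermitian inner product: $\langle\vec x,\vec y\rangle_h=\sum_i x_i^qy_i$; the Hermitian dual of $C$ is $\{\vec x\mid\langle\vec x,\vec y\rangle_h=0\ \forall\,\vec y\in C\}$. *)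

theory Defs
  imports "HOL-Algebra.QuotRing" "HOL-Number_Theory.Prime_Powers" "Jordan_Normal_Form.VS_Connect"
begin

hide_const (open) Modules.module

text \<open>
  \<open>class_ring\<close> at type \<open>'a poly\<close> is \<open>F[x]\<close>, so \<open>cyc_ring n\<close> is \<open>F[x]/(x^n - 1)\<close> and
  \<open>cyc_class n a\<close> is the class \<open>[a]\<close> in it.
\<close>

abbreviation cyc_ideal :: "nat \<Rightarrow> 'a::field poly set" where
  "cyc_ideal n \<equiv> PIdl\<^bsub>class_ring\<^esub> (monom 1 n - 1)"

definition cyc_ring :: "nat \<Rightarrow> 'a::field poly set ring" where
  "cyc_ring n = class_ring Quot cyc_ideal n"

definition cyc_class :: "nat \<Rightarrow> 'a::field poly \<Rightarrow> 'a poly set" where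
  "cyc_class n a = cyc_ideal n +>\<^bsub>class_ring\<^esub> a"

definition self_module :: "'r ring \<Rightarrow> ('r, 'r) module" where
  "self_module R = ring.extend R (module.fields (\<otimes>\<^bsub>R\<^esub>))"

definition cyc_module2 :: "nat \<Rightarrow> ('a::field poly set, 'a poly set \<times> 'a poly set) module" where
  "cyc_module2 n = direct_sum (self_module (cyc_ring n)) (self_module (cyc_ring n))"

lemma cring_cyc_ring: "cring (cyc_ring n :: 'a::field poly set ring)"
proof -
  have R: "cring (class_ring :: 'a poly ring)" by unfold_locales auto
  have "ideal (cyc_ideal n) (class_ring :: 'a poly ring)"
    by (rule cring.cgenideal_ideal[OF R]) simp
  then show ?thesis unfolding cyc_ring_def using R by (rule ideal.quotient_is_cring)
qed

lemma module_self_module: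
  assumes "cring R" shows "module R (self_module R)"
proof -
  interpret cring R by fact
  have "abelian_group (self_module R)"
  proof (rule abelian_groupI)
    fix x assume "x \<in> carrier (self_module R)"
    then show "\<exists>y\<in>carrier (self_module R). y \<oplus>\<^bsub>self_module R\<^esub> x = \<zero>\<^bsub>self_module R\<^esub>"
      by (intro bexI[of _ "\<ominus>\<^bsub>R\<^esub> x"]) (auto simp: self_module_def ring.defs module.defs l_neg)
  qed (auto simp: self_module_def ring.defs module.defs a_ac)
  then show ?thesis
    by (intro moduleI)
      (auto simp: self_module_def ring.defs module.defs l_distr r_distr m_assoc is_cring)
qed

lemma module_cyc_module2:
  "module (cyc_ring n) (cyc_module2 n :: (_, 'a::field poly set \<times> 'a poly set) module)"
  unfolding cyc_module2_def
  by (intro direct_sum_is_module module_self_module cring_cyc_ring)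

definition class_of_vec :: "'a::field vec \<Rightarrow> 'a poly set" where
  "class_of_vec v = cyc_class (dim_vec v) (\<Sum>i<dim_vec v. monom (v $ i) i)"

text \<open>
  The quasi-cyclic code \<open>Q(f,g,h)\<close>, as the set of vectors of length \<open>2 n\<close> whose image
  under the identification of \<open>F^(2n)\<close> with the square of the quotient ring lies in the
  submodule generated by \<open>([f],[h f])\<close> and \<open>(0,[g])\<close>.
\<close>

definition qc_code :: "nat \<Rightarrow> 'a::field poly \<Rightarrow> 'a poly \<Rightarrow> 'a poly \<Rightarrow> 'a vec set" where
  "qc_code n f g h = {v \<in> carrier_vec (2 * n).
     (class_of_vec (vec_first v n), class_of_vec (vec_last v n)) \<in>
       module.span (cyc_ring n) (cyc_module2 n)
         {(cyc_class n f, cyc_class n (h * f)), (\<zero>\<^bsub>cyc_ring n\<^esub>, cyc_class n g)}}"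

definition coeff_power :: "nat \<Rightarrow> 'a::field poly \<Rightarrow> 'a poly" where
  "coeff_power q u = map_poly (\<lambda>c. c ^ q) u"

text \<open>
  Meant for divisors \<open>u\<close> of \<open>x^n - 1\<close>, where the division is exact. \<open>reflect_poly p\<close> is
  \<open>x^(degree p) p(1/x)\<close>.
\<close>

definition perp_poly :: "nat \<Rightarrow> 'a::field poly \<Rightarrow> 'a poly" where
  "perp_poly n u = reflect_poly ((monom 1 n - 1) div u)"

text \<open>
  The parameter \<open>q\<close> is the exponent of the conjugation, so the field is meant to have
  \<open>q^2\<close> elements.
\<close>

definition herm_prod :: "nat \<Rightarrow> 'a::field vec \<Rightarrow> 'a vec \<Rightarrow> 'a" where
  "herm_prod q x y = (\<Sum>i<dim_vec y. (x $ i) ^ q * y $ i)"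

definition herm_dual :: "nat \<Rightarrow> nat \<Rightarrow> 'a::field vec set \<Rightarrow> 'a vec set" where
  "herm_dual q m C = {x \<in> carrier_vec m. \<forall>y\<in>C. herm_prod q x y = 0}"

end

theory Submission
  imports "HOL-Number_Theory.Residues" Defs
begin

text \<open>
  Since \<open>f\<close> divides \<open>g\<close>, the code contains every pair \<open>(u, v)\<close> with \<open>g\<close> dividing both \<open>u\<close> and
  \<open>v\<close>, whatever \<open>h\<close> is. A vector of the Hermitian dual is therefore orthogonal to all
  \<open>(x^j g, 0)\<close> and \<open>(0, x^j g)\<close>, so each of its halves lies in the Hermitian dual of the cyclic
  code of \<open>g\<close> and is divisible by the perp polynomial of \<open>g\<close> with conjugated coefficients. By
  hypothesis \<open>g\<close> divides that polynomial, so the vector belongs to the code again.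
\<close>

section \<open>Reversal of polynomials and orthogonality to shifts\<close>

lemma reflect_poly_monom_mult:
  fixes p :: "'a::idom poly"
  shows "reflect_poly (monom 1 k * p) = reflect_poly p"
proof (cases "p = 0")
  case False
  then show ?thesis
    by (induction k) (simp_all add: monom_Suc reflect_poly_pCons')
qed simp

text \<open>Reversing twice strips the largest power of \<open>x\<close> from \<open>p\<close> and
  changes nothing else.\<close>

lemma reflect_reflect_poly_dvd:
  fixes p :: "'a::idom poly"
  shows "reflect_poly (reflect_poly p) dvd p"
proof (induction p)
  case (pCons a p)
  show ?case
  proof (cases "a = 0")
    case True
    then have "pCons a p = monom 1 (Suc 0) * p"
      by (simp add: monom_Suc)
    then show ?thesis
      using pCons.IH by (simp only: reflect_poly_monom_mult dvd_mult)
  qed (simp add: reflect_poly_reflect_poly)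
qed simp

text \<open>
  Let \<open>V\<close> be \<open>x^(n - 1) w(1/x)\<close>. Orthogonality says that the coefficients of \<open>V G\<close> vanish from
  \<open>degree G\<close> up to \<open>n - 1\<close>, so that \<open>V G = A + x^n B\<close> with \<open>A\<close> and \<open>B\<close> of degree less than
  \<open>degree G\<close>. Then \<open>G\<close> divides \<open>A + B\<close>, which forces \<open>A + B = 0\<close> and \<open>V G = (x^n - 1) B\<close>.
\<close>

lemma perp_poly_dvdI:
  fixes G w :: "'a::field poly"
  assumes G: "G dvd monom 1 n - 1" and n: "n \<ge> 1" and w: "degree w < n"
    and orth: "\<And>j. j + degree G < n \<Longrightarrow> (\<Sum>i<n. coeff w i * coeff (monom 1 j * G) i) = 0"
  shows "perp_poly n G dvd w"
proof -
  \<comment> \<open>\<open>reflect_poly\<close> reverses \<open>w\<close> within its own degree; the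
    power of \<open>x\<close> pads this to a reversal within length \<open>n\<close>.\<close>
  define V where "V = monom 1 (n - 1 - degree w) * reflect_poly w"
  define A where "A = poly_cutoff n (V * G)"
  define B where "B = poly_shift n (V * G)"
  obtain k where k: "monom 1 n - 1 = G * k"
    using G by (elim dvdE)
  have "coeff (monom 1 n - 1 :: 'a poly) n \<noteq> 0"
    using n by simp
  then have X: "monom 1 n - 1 \<noteq> (0 :: 'a poly)"
    by (metis coeff_0)
  then have G0: "G \<noteq> 0"
    using k by auto
  have cV: "coeff V m = (if m < n then coeff w (n - 1 - m) else 0)" for m
    using w coeff_eq_0[of w] by (auto simp: V_def coeff_monom_mult coeff_reflect_poly)
  have degV: "degree V \<le> n - 1"
    by (rule degree_le) (use cV in auto)
  have cVG: "coeff (V * G) m = 0" if m: "degree G \<le> m" "m < n" for m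
  proof -
    \<comment> \<open>The coefficient of \<open>V * G\<close> at \<open>m\<close> pairs
      \<open>w\<close> with \<open>G\<close> shifted by \<open>n - 1 - m\<close>; the bound
      \<open>degree G \<le> m\<close> says that this shift still fits below
      \<open>n\<close>.\<close>
    define j where "j = n - 1 - m"
    have "(\<Sum>i<n. coeff w i * coeff (monom 1 j * G) i)
        = (\<Sum>i\<in>{j..<n}. coeff w i * coeff G (i - j))"
      by (rule sum.mono_neutral_cong_right) (auto simp: coeff_monom_mult)
    also have "\<dots> = (\<Sum>t\<le>m. coeff V t * coeff G (m - t))"
    proof (rule sum.reindex_bij_witness[of _ "\<lambda>t. n - 1 - t" "\<lambda>i. n - 1 - i"])
      fix i assume "i \<in> {j..<n}"
      then have "i < n" "m - (n - 1 - i) = i - j" "n - 1 - i < n" "n - 1 - (n - 1 - i) = i"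
        using m by (auto simp: j_def)
      then show "coeff V (n - 1 - i) * coeff G (m - (n - 1 - i)) = coeff w i * coeff G (i - j)"
        by (simp only: cV if_True)
    qed (use m in \<open>auto simp: j_def\<close>)
    also have "\<dots> = coeff (V * G) m"
      by (simp add: coeff_mult)
    finally show ?thesis
      using orth[of j] m by (simp add: j_def)
  qed
  have VG: "V * G = A + monom 1 n * B"
    by (rule poly_eqI) (auto simp: A_def B_def coeff_monom_mult coeff_poly_cutoff coeff_poly_shift)
  have "coeff A i = 0" if "i \<ge> degree G" for i
    using cVG that by (auto simp: A_def coeff_poly_cutoff)
  moreover have "coeff B i = 0" if "i \<ge> degree G" for i
  proof -
    have "degree (V * G) < i + n"
      using degree_mult_le[of V G] degV n that by linarith
    then show ?thesis
      by (simp add: B_def coeff_poly_shift coeff_eq_0)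
  qed
  ultimately have cAB: "coeff (A + B) i = 0" if "i \<ge> degree G" for i
    using that by simp
  \<comment> \<open>Replacing \<open>x^n\<close> by \<open>1\<close> changes \<open>V * G\<close> by
    a multiple of \<open>x^n - 1\<close>, hence of \<open>G\<close>.\<close>
  have AB: "A + B = V * G - G * k * B"
    unfolding k[symmetric] VG by (simp add: algebra_simps)
  then have "G dvd A + B"
    by (simp add: mult.assoc dvd_diff)
  then have "A + B = 0"
    using cAB[of "degree (A + B)"] dvd_imp_degree_le[of G "A + B"] leading_coeff_0_iff[of "A + B"]
    by blast
  with AB have "V * G = G * k * B"
    by simp
  then have "G * V = G * (k * B)"
    by (simp only: mult.commute[of V G] mult.assoc)
  then have "V = k * B"
    using G0 by (simp only: mult_cancel_left) simp
  \<comment> \<open>Reversal is multiplicative, and \<open>k\<close> is the cofactor of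
    \<open>G\<close>, so its reversal is \<open>perp_poly n G\<close>.\<close>
  then have "reflect_poly k dvd reflect_poly V"
    by (simp add: reflect_poly_mult)
  also have "reflect_poly V = reflect_poly (reflect_poly w)"
    by (simp add: V_def reflect_poly_monom_mult)
  also have "\<dots> dvd w"
    by (rule reflect_reflect_poly_dvd)
  finally show ?thesis
    using k G0 by (simp add: perp_poly_def)
qed

section \<open>Finite fields and conjugation of coefficients\<close>

text \<open>Multiplication by a nonzero \<open>x\<close> permutes the nonzero elements; comparing
  their product before and after gives \<open>x^(card - 1) = 1\<close>.\<close>

lemma finite_field_power_card:
  fixes x :: "'a::{field,finite}"
  shows "x ^ card (UNIV :: 'a set) = x"
proof (cases "x = 0")
  case False
  let ?P = "\<Prod>(UNIV - {0 :: 'a})"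
  have "bij_betw ((*) x) (UNIV - {0}) (UNIV - {0})"
    by (rule bij_betw_byWitness[where f' = "\<lambda>y. y / x"]) (use False in auto)
  then have "(\<Prod>y\<in>UNIV - {0}. x * y) = ?P"
    by (rule prod.reindex_bij_betw)
  then have "x ^ (card (UNIV :: 'a set) - 1) * ?P = 1 * ?P"
    by (simp add: prod.distrib)
  moreover have "?P \<noteq> 0"
    by simp
  ultimately have "x ^ (card (UNIV :: 'a set) - 1) = 1"
    by (simp only: mult_cancel_right) simp
  moreover have "card (UNIV :: 'a set) = Suc (card (UNIV :: 'a set) - 1)"
    by (simp add: finite_UNIV_card_ge_0)
  ultimately show ?thesis
    by (metis mult.right_neutral power_Suc)
qed (simp add: finite_UNIV_card_ge_0)

text \<open>The characteristic divides the order of the field, so it is the prime underlying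
  \<open>q\<close>. This makes the \<open>q\<close>-th power map an iterated Frobenius, hence
  additive.\<close>

lemma primepow_card_eq_CHAR_power:
  assumes "primepow q" and "card (UNIV :: 'a::{field,finite} set) = q\<^sup>2"
  shows "prime CHAR('a)" and "\<exists>k. q = CHAR('a) ^ k"
proof -
  show p: "prime CHAR('a)"
    by (intro prime_CHAR_semidom finite_imp_CHAR_pos) simp
  obtain r k where r: "prime r" and q: "q = r ^ k"
    using assms(1) by (auto simp: primepow_def)
  have "CHAR('a) dvd r ^ (k * 2)"
    using CHAR_dvd_CARD[where 'a = 'a] assms(2) q by (simp add: power_mult)
  then have "CHAR('a) = r"
    using p r by (metis prime_dvd_power primes_dvd_imp_eq)
  then show "\<exists>k. q = CHAR('a) ^ k"
    using q by auto
qed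

lemma coeff_coeff_power:
  assumes "q > 0"
  shows "coeff (coeff_power q u) i = coeff u i ^ q"
  using assms by (simp add: coeff_power_def coeff_map_poly)

text \<open>Conjugating coefficients is a ring endomorphism of the polynomial ring that fixes
  \<open>x^n - 1\<close>, so it preserves divisibility into it.\<close>

lemma coeff_power_dvd:
  fixes u :: "'a::field poly"
  assumes "prime CHAR('a)" and q: "q = CHAR('a) ^ k" and "u dvd monom 1 n - 1"
  shows "coeff_power q u dvd monom 1 n - 1"
proof -
  have q0: "q > 0"
    using assms(1) q by (simp add: prime_gt_0_nat)
  note c = coeff_coeff_power[OF q0]
  have mult: "coeff_power q (a * b) = coeff_power q a * coeff_power q b" for a b :: "'a poly"
    by (rule poly_eqI)
      (simp add: c coeff_mult freshmans_dream_sum'[OF assms(1) q] power_mult_distrib)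
  have add: "coeff_power q (a + b) = coeff_power q a + coeff_power q b" for a b :: "'a poly"
    by (rule poly_eqI) (simp add: c freshmans_dream'[OF assms(1) q])
  have mon: "coeff_power q (monom 1 m) = (monom 1 m :: 'a poly)" for m
    by (rule poly_eqI) (use q0 in \<open>simp add: c\<close>)
  have one: "coeff_power q 1 = (1 :: 'a poly)"
    using mon[of 0] by simp
  have "coeff_power q (monom 1 n - 1) + coeff_power q 1 = (monom 1 n :: 'a poly)"
    using add[of "monom 1 n - 1" 1] by (simp add: mon)
  then have "coeff_power q (monom 1 n - 1 :: 'a poly) = monom 1 n - 1"
    by (simp add: one algebra_simps)
  then show ?thesis
    using assms(3) mult by (metis dvdE dvd_triv_left)
qed

section \<open>Code membership through polynomial representatives\<close>

definition vec_poly :: "'a::comm_monoid_add vec \<Rightarrow> 'a poly" where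
  "vec_poly v = (\<Sum>i<dim_vec v. monom (v $ i) i)"

lemma coeff_vec_poly: "coeff (vec_poly v) i = (if i < dim_vec v then v $ i else 0)"
  by (simp add: vec_poly_def coeff_sum)

lemma class_of_vec_eq: "class_of_vec v = cyc_class (dim_vec v) (vec_poly v)"
  by (simp add: class_of_vec_def vec_poly_def)

lemma vec_poly_coeff:
  fixes p :: "'a::comm_monoid_add poly"
  assumes "degree p < n"
  shows "vec_poly (vec n (coeff p)) = p"
  using assms by (intro poly_eqI) (auto simp: coeff_vec_poly coeff_eq_0)

lemma cyc_class_hom: "cyc_class n \<in> Ring.ring_hom (class_ring :: 'a::field poly ring) (cyc_ring n)"
proof -
  have R: "cring (class_ring :: 'a poly ring)"
    by unfold_locales auto
  have "ideal (cyc_ideal n) (class_ring :: 'a poly ring)"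
    by (rule cring.cgenideal_ideal[OF R]) simp
  then have "(+>\<^bsub>class_ring\<^esub>) (cyc_ideal n) \<in> Ring.ring_hom (class_ring :: 'a poly ring) (cyc_ring n)"
    unfolding cyc_ring_def by (rule ideal.rcos_ring_hom)
  moreover have "cyc_class n = (+>\<^bsub>class_ring\<^esub>) (cyc_ideal n :: 'a poly set)"
    by (simp add: cyc_class_def fun_eq_iff)
  ultimately show ?thesis
    by simp
qed

text \<open>If the halves are \<open>a f\<close> and \<open>h a f + b g\<close>, their classes form
  the combination of the two generators with coefficients \<open>[a]\<close> and
  \<open>[b]\<close>.\<close>

lemma mem_qc_codeI:
  fixes f g h :: "'a::field poly"
  assumes x: "x \<in> carrier_vec (2 * n)"
    and f: "f dvd vec_poly (vec_first x n)"
    and g: "g dvd vec_poly (vec_last x n) - h * vec_poly (vec_first x n)"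
  shows "x \<in> qc_code n f g h"
proof -
  let ?R = "cyc_ring n :: 'a poly set ring" and ?M = "cyc_module2 n :: (_, 'a poly set \<times> _) module"
  let ?c = "cyc_class n :: 'a poly \<Rightarrow> _"
  let ?S = "{(?c f, ?c (h * f)), (\<zero>\<^bsub>?R\<^esub>, ?c g)}"
  interpret M: module ?R ?M
    by (rule module_cyc_module2)
  note hom = cyc_class_hom[of n]
  have c: "?c a \<in> carrier ?R" for a
    using ring_hom_closed[OF hom] by simp
  have cm: "?c (a * b) = ?c a \<otimes>\<^bsub>?R\<^esub> ?c b" for a b
    using ring_hom_mult[OF hom] by simp
  have ca: "?c (a + b) = ?c a \<oplus>\<^bsub>?R\<^esub> ?c b" for a b
    using ring_hom_add[OF hom] by simp
  have M: "carrier ?M = carrier ?R \<times> carrier ?R"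
    "a \<odot>\<^bsub>?M\<^esub> (y, z) = (a \<otimes>\<^bsub>?R\<^esub> y, a \<otimes>\<^bsub>?R\<^esub> z)"
    "(y, z) \<oplus>\<^bsub>?M\<^esub> (y', z') = (y \<oplus>\<^bsub>?R\<^esub> y', z \<oplus>\<^bsub>?R\<^esub> z')" for a y z y' z'
    by (auto simp: cyc_module2_def self_module_def direct_sum_def ring.defs module.defs)
  have S: "?S \<subseteq> carrier ?M"
    using c by (auto simp: M(1))
  interpret N: submodule ?R "M.span ?S" ?M
    using S by (rule M.span_is_submodule)
  from f obtain a where a: "vec_poly (vec_first x n) = f * a"
    by (elim dvdE)
  from g obtain b where b: "vec_poly (vec_last x n) - h * vec_poly (vec_first x n) = g * b"
    by (elim dvdE)
  have l: "vec_poly (vec_last x n) = a * (h * f) + b * g"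
    using a b by (simp add: algebra_simps)
  have "?c a \<odot>\<^bsub>?M\<^esub> (?c f, ?c (h * f)) \<oplus>\<^bsub>?M\<^esub> ?c b \<odot>\<^bsub>?M\<^esub> (\<zero>\<^bsub>?R\<^esub>, ?c g) \<in> M.span ?S"
    using M.in_own_span[OF S] c by (intro N.m_closed N.smult_closed) auto
  also have "?c a \<odot>\<^bsub>?M\<^esub> (?c f, ?c (h * f)) \<oplus>\<^bsub>?M\<^esub> ?c b \<odot>\<^bsub>?M\<^esub> (\<zero>\<^bsub>?R\<^esub>, ?c g)
      = (?c (vec_poly (vec_first x n)), ?c (vec_poly (vec_last x n)))"
    using c by (simp add: M a l ca cm M.R.m_comm)
  finally show ?thesis
    using x by (simp add: qc_code_def class_of_vec_eq)
qed

theorem proposition14: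
  fixes f g h :: "'a::{field,finite} poly" and q n :: nat
  assumes "primepow q"
    and "card (UNIV :: 'a set) = q\<^sup>2"
    and "n \<ge> 1"
    and "lead_coeff f = 1" and "lead_coeff g = 1" and "lead_coeff h = 1"
    and "degree f < n" and "degree g < n" and "degree h < n"
    and "f dvd monom 1 n - 1" and "g dvd monom 1 n - 1"
    and "f dvd g"
    and "g dvd perp_poly n (coeff_power q g)"
    and "perp_poly n (coeff_power q g) dvd perp_poly n (coeff_power q f)"
  shows "herm_dual q (2 * n) (qc_code n f g h) \<subseteq> qc_code n f g h"
proof
  fix x assume "x \<in> herm_dual q (2 * n) (qc_code n f g h)"
  then have x: "x \<in> carrier_vec (2 * n)"
    and orth: "\<And>y. y \<in> qc_code n f g h \<Longrightarrow> herm_prod q x y = 0"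
    by (auto simp: herm_dual_def)
  obtain k where p: "prime CHAR('a)" and q: "q = CHAR('a) ^ k"
    using primepow_card_eq_CHAR_power[OF assms(1,2)] by blast
  have q0: "q > 0"
    using p q by (simp add: prime_gt_0_nat)
  \<comment> \<open>Conjugation is an involution because the field has \<open>q^2\<close>
    elements.\<close>
  have frob2: "(c ^ q) ^ q = c" for c :: 'a
    using finite_field_power_card[of c] assms(2) by (simp add: power2_eq_square power_mult)
  \<comment> \<open>From \<open>f dvd g\<close> it follows that \<open>f\<close> divides
    \<open>a\<close>, and \<open>g\<close> divides \<open>b - h * a\<close> for any
    \<open>h\<close>.\<close>
  have code: "vec n (coeff a) @\<^sub>v vec n (coeff b) \<in> qc_code n f g h"
    if "degree a < n" "degree b < n" "g dvd a" "g dvd b" for a b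
  proof -
    have "vec_first (vec n (coeff a) @\<^sub>v vec n (coeff b)) n = vec n (coeff a)"
      "vec_last (vec n (coeff a) @\<^sub>v vec n (coeff b)) n = vec n (coeff b)"
      "vec n (coeff a) @\<^sub>v vec n (coeff b) \<in> carrier_vec (2 * n)"
      by (auto simp: vec_first_def vec_last_def intro: carrier_vecI)
    then show ?thesis
      using that assms(12) by (intro mem_qc_codeI) (auto simp: vec_poly_coeff intro: dvd_trans)
  qed
  have split: "herm_prod q x (vec n c @\<^sub>v vec n d)
      = (\<Sum>i<n. (vec_first x n $ i) ^ q * c i) + (\<Sum>i<n. (vec_last x n $ i) ^ q * d i)" for c d
  proof -
    have "herm_prod q x (vec n c @\<^sub>v vec n d)
        = (\<Sum>i\<in>{..<n} \<union> {n..<n + n}. (x $ i) ^ q * (vec n c @\<^sub>v vec n d) $ i)"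
      by (auto simp: herm_prod_def intro!: sum.cong)
    also have "\<dots> = (\<Sum>i<n. (x $ i) ^ q * (vec n c @\<^sub>v vec n d) $ i)
        + (\<Sum>i\<in>{n..<n + n}. (x $ i) ^ q * (vec n c @\<^sub>v vec n d) $ i)"
      by (rule sum.union_disjoint) auto
    also have "(\<Sum>i<n. (x $ i) ^ q * (vec n c @\<^sub>v vec n d) $ i) = (\<Sum>i<n. (x $ i) ^ q * c i)"
      by simp
    also have "(\<Sum>i\<in>{n..<n + n}. (x $ i) ^ q * (vec n c @\<^sub>v vec n d) $ i) = (\<Sum>i<n. (x $ (n + i)) ^ q * d i)"
      by (rule sum.reindex_bij_witness[of _ "\<lambda>i. n + i" "\<lambda>i. i - n"]) auto
    finally show ?thesis
      using x by (simp add: vec_first_def vec_last_def)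
  qed
  have degq: "degree (coeff_power q g) = degree g"
    using q0 by (simp add: coeff_power_def degree_map_poly)
  have dvd: "g dvd vec_poly w"
    if w: "dim_vec w = n"
      and o: "\<And>j. j + degree g < n \<Longrightarrow> (\<Sum>i<n. (w $ i) ^ q * coeff (monom 1 j * g) i) = 0" for w
  proof -
    have "perp_poly n (coeff_power q g) dvd vec_poly w"
    proof (rule perp_poly_dvdI)
      show "coeff_power q g dvd monom 1 n - 1"
        using p q assms(11) by (rule coeff_power_dvd)
      have "degree (vec_poly w) \<le> n - 1"
        by (rule degree_le) (use w in \<open>auto simp: coeff_vec_poly\<close>)
      then show "degree (vec_poly w) < n"
        using assms(3) by simp
      fix j assume "j + degree (coeff_power q g) < n"
      \<comment> \<open>Raising the relation to the power \<open>q\<close> moves the conjugation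
        from \<open>w\<close> to \<open>g\<close>, turning Hermitian orthogonality to the shifts of
        \<open>g\<close> into bilinear orthogonality to those of
        \<open>coeff_power q g\<close>.\<close>
      then have "(\<Sum>i<n. (w $ i) ^ q * coeff (monom 1 j * g) i) ^ q = 0"
        using o[of j] q0 by (simp add: degq)
      then have "(\<Sum>i<n. w $ i * coeff (monom 1 j * g) i ^ q) = 0"
        by (simp add: freshmans_dream_sum'[OF p q] power_mult_distrib frob2)
      moreover have "coeff (monom 1 j * g) i ^ q = coeff (monom 1 j * coeff_power q g) i" for i
        using q0 by (simp add: coeff_monom_mult coeff_coeff_power)
      ultimately show "(\<Sum>i<n. coeff (vec_poly w) i * coeff (monom 1 j * coeff_power q g) i) = 0"
        using w by (simp add: coeff_vec_poly)
    qed (use assms(3) in simp)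
    then show ?thesis
      using assms(13) dvd_trans by blast
  qed
  \<comment> \<open>These shifts need no reduction modulo \<open>x^n - 1\<close>, so their
    coefficient vectors serve directly as test words in either half.\<close>
  have deg: "degree (monom 1 j * g) < n" if "j + degree g < n" for j
    using that degree_mult_le[of "monom 1 j" g] degree_monom_le[of "1 :: 'a" j] by linarith
  have "g dvd vec_poly (vec_first x n)"
    using orth[OF code[OF deg, of _ 0]] assms(3) by (intro dvd) (simp_all add: split)
  moreover have "g dvd vec_poly (vec_last x n)"
    using orth[OF code[OF _ deg, of 0]] assms(3) by (intro dvd) (simp_all add: split)
  ultimately show "x \<in> qc_code n f g h"
    using x assms(12) by (intro mem_qc_codeI) (auto intro: dvd_trans)
qed

end
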